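(* Let $a,b\in\mathbb{R}$ with $b-a$ a positive integer, let $\alpha\in(0,1/2)$, and let $p,q,r$ be real-valued functions on $\mathbb{N}_{a,b-1}$ with $p(t)\ne0$ and $r(t)>0$ for all $t\in\mathbb{N}_{a,b-1}$. Let $c_1,c_2,d_1,d_2$ be constants with $c_1^2+c_2^2\ne0$ and $d_1^2+d_2^2\neq0$. Then the eigenvalues of the nabla discrete fractional Sturm--Liouville problem $${}^{ABC}_{a}\nabla^\alpha\big(p(t)\,{}^{ABR}\nabla^\alpha_b x(t)\big)+q(t)x(t)=\lambda r(t)x(t),\qquad t\in\mathbb{N}_{a+1,b-1},$$ $$c_1\,\mathbf{E}^1_{\overline{\alpha,1},\frac{-\alpha}{1-\alpha},b^-}x(a)+c_2\,{}^{ABR}\nabla_b^\alpha x(a)=0,$$ $$d_1\,\mathbf{E}^1_{\overline{\alpha,1},\frac{-\alpha}{1-\alpha},b^-}x(b-1)+d_2\,{}^{ABR}\nabla_b^\alpha x(b-1)=0$$ are real.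
   Context: Notation: $\mathbb{N}_{c,d}=\{c,c+1,\dots,d\}$; $\rho(t)=t-1$ is the backward jump operator; $\nabla f(t)=f(t)-f(t-1)$, $\Delta f(t)=f(t+1)-f(t)$; empty sums are $0$. The rising function is $t^{\overline{\gamma}}=\Gamma(t+\gamma)/\Gamma(t)$ for $t\in\mathbb{R}\setminus\{\dots,-2,-1,0\}$, and $0^{\overline{\gamma}}=0$. For $\mu\in\mathbb{R}$, $|\mu|<1$, the nabla discrete Mittag-Leffler function is $E_{\overline{\alpha}}(\mu,z)=\sum_{k=0}^\infty\mu^k\frac{z^{\overline{k\alpha}}}{\Gamma(\alpha k+1)}$. $B(\alpha)>0$ is a normalization function with $B(0)=B(1)=1$. The discrete right generalized fractional integral operator (with second parameter $1$) is $$\mathbf{E}^1_{\overline{\alpha,1},\frac{-\alpha}{1-\alpha},b^-}f(t)=\sum_{s=t}^{b-1}E_{\overline{\alpha}}\Big(\tfrac{-\alpha}{1-\alpha},s-\rho(t)\Big)f(s),$$ the right ABR (Riemann--Liouville type) fractional difference is $${}^{ABR}\nabla_b^\alpha f(t)=-\frac{B(\alpha)}{1-\alpha}\Delta_t\sum_{s=t}^{b-1} f(s)E_{\overline{\alpha}}\Big(\tfrac{-\alpha}{1-\alpha},s-\rho(t)\Big),\quad t\in\{\dots,b-2,b-1\},$$ and the left ABC (Caputo type) fractional difference is $${}^{ABC}_{a}\nabla^\alpha f(t)=\frac{B(\alpha)}{1-\alpha}\sum_{s=a+1}^t \nabla f(s)\,E_{\overline{\alpha}}\Big(\tfrac{-\alpha}{1-\alpha},t-\rho(s)\Big),\quad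 t\in\{a+1,a+2,\dots\}.$$ An eigenvalue is a (possibly complex) $\lambda$ for which the problem (equation together with both boundary conditions) has a nontrivial (possibly complex-valued) solution $x$; such an $x$ is called a corresponding eigenfunction.
   Formalization: The formal theorem additionally assumes that the set N_{a+1,b-1} is nonempty, i.e. b-a≥2; for b-a=1 the equation is vacuous and, e.g. with c1=d1=-B(α)/(1-α), c2=d2=1, every complex λ is an eigenvalue, so the claim fails. *)

theory Defs
  imports "HOL-Analysis.Analysis"
begin

text \<open>The discrete interval \<open>{c, c+1, ..., d}\<close> on the real line; it is empty for \<open>d < c\<close>,
  so that a sum from \<open>c\<close> to \<open>c - 1\<close> is 0.\<close>

definition dint :: "real \<Rightarrow> real \<Rightarrow> real set" where
  "dint c d = {c + real k | k. c + real k \<le> d}"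

definition \<rho> :: "real \<Rightarrow> real" where
  "\<rho> t = t - 1"

definition nabla :: "(real \<Rightarrow> complex) \<Rightarrow> real \<Rightarrow> complex" where
  "nabla f t = f t - f (t - 1)"

definition fdiff :: "(real \<Rightarrow> complex) \<Rightarrow> real \<Rightarrow> complex" where
  "fdiff f t = f (t + 1) - f t"

text \<open>The value at a negative integer \<open>t\<close> is left undefined in the literature (here it is 0);
  only \<open>t > 0\<close> enters below.\<close>

definition rising :: "real \<Rightarrow> real \<Rightarrow> real" where
  "rising t \<gamma> = (if t = 0 then 0 else Gamma (t + \<gamma>) / Gamma t)"

text \<open>Only meaningful for \<open>\<bar>\<mu>\<bar> < 1\<close>.\<close>

definition nabla_ML :: "real \<Rightarrow> real \<Rightarrow> real \<Rightarrow> real" where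
  "nabla_ML \<alpha> \<mu> z = (\<Sum>k. \<mu> ^ k * (rising z (real k * \<alpha>) / Gamma (\<alpha> * real k + 1)))"

definition normalization_fun :: "(real \<Rightarrow> real) \<Rightarrow> bool" where
  "normalization_fun B \<longleftrightarrow> (\<forall>\<alpha>\<in>{0..1}. B \<alpha> > 0) \<and> B 0 = 1 \<and> B 1 = 1"

text \<open>The case of second Mittag-Leffler parameter 1 of the generalized integral operator.\<close>

definition right_gen_int :: "real \<Rightarrow> real \<Rightarrow> real \<Rightarrow> (real \<Rightarrow> complex) \<Rightarrow> real \<Rightarrow> complex" where
  "right_gen_int \<alpha> \<omega> b f t =
     (\<Sum>s\<in>dint t (b - 1). of_real (nabla_ML \<alpha> \<omega> (s - \<rho> t)) * f s)"

definition right_ABR ::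
    "(real \<Rightarrow> real) \<Rightarrow> real \<Rightarrow> real \<Rightarrow> (real \<Rightarrow> complex) \<Rightarrow> real \<Rightarrow> complex" where
  "right_ABR B \<alpha> b f t =
     - of_real (B \<alpha> / (1 - \<alpha>)) *
       fdiff (\<lambda>u. \<Sum>s\<in>dint u (b - 1).
         f s * of_real (nabla_ML \<alpha> (- \<alpha> / (1 - \<alpha>)) (s - \<rho> u))) t"

definition left_ABC ::
    "(real \<Rightarrow> real) \<Rightarrow> real \<Rightarrow> real \<Rightarrow> (real \<Rightarrow> complex) \<Rightarrow> real \<Rightarrow> complex" where
  "left_ABC B \<alpha> a f t =
     of_real (B \<alpha> / (1 - \<alpha>)) *
       (\<Sum>s\<in>dint (a + 1) t.
         nabla f s * of_real (nabla_ML \<alpha> (- \<alpha> / (1 - \<alpha>)) (t - \<rho> s)))"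

text \<open>Only the values of \<open>x\<close>, \<open>p\<close>, \<open>q\<close>, \<open>r\<close> on \<open>dint a (b - 1)\<close> matter, so
  nontriviality of \<open>x\<close> is asserted on that set. If \<open>b - a = 1\<close>, the difference equation is
  posed on the empty set; \<open>\<Lambda>\<close> is then unconstrained and, for suitable boundary constants, every
  complex number is an eigenvalue.\<close>

definition SL_eigenfunction ::
    "(real \<Rightarrow> real) \<Rightarrow> real \<Rightarrow> real \<Rightarrow> real \<Rightarrow> (real \<Rightarrow> real) \<Rightarrow> (real \<Rightarrow> real) \<Rightarrow> (real \<Rightarrow> real) \<Rightarrow>
      real \<Rightarrow> real \<Rightarrow> real \<Rightarrow> real \<Rightarrow> complex \<Rightarrow> (real \<Rightarrow> complex) \<Rightarrow> bool" where
  "SL_eigenfunction B \<alpha> a b p q r c1 c2 d1 d2 \<Lambda> x \<longleftrightarrow>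
     (\<exists>t\<in>dint a (b - 1). x t \<noteq> 0) \<and>
     (\<forall>t\<in>dint (a + 1) (b - 1).
        left_ABC B \<alpha> a (\<lambda>u. of_real (p u) * right_ABR B \<alpha> b x u) t + of_real (q t) * x t
          = \<Lambda> * of_real (r t) * x t) \<and>
     of_real c1 * right_gen_int \<alpha> (- \<alpha> / (1 - \<alpha>)) b x a + of_real c2 * right_ABR B \<alpha> b x a = 0 \<and>
     of_real d1 * right_gen_int \<alpha> (- \<alpha> / (1 - \<alpha>)) b x (b - 1) + of_real d2 * right_ABR B \<alpha> b x (b - 1) = 0"

definition SL_eigenvalue ::
    "(real \<Rightarrow> real) \<Rightarrow> real \<Rightarrow> real \<Rightarrow> real \<Rightarrow> (real \<Rightarrow> real) \<Rightarrow> (real \<Rightarrow> real) \<Rightarrow> (real \<Rightarrow> real) \<Rightarrow>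
      real \<Rightarrow> real \<Rightarrow> real \<Rightarrow> real \<Rightarrow> complex \<Rightarrow> bool" where
  "SL_eigenvalue B \<alpha> a b p q r c1 c2 d1 d2 \<Lambda> \<longleftrightarrow>
     (\<exists>x. SL_eigenfunction B \<alpha> a b p q r c1 c2 d1 d2 \<Lambda> x)"

end

theory Submission imports Defs begin

text \<open>Write \<open>X\<close> for the right integral operator applied to an eigenfunction \<open>x\<close> and \<open>y\<close> for its
  ABR difference, a positive multiple of \<open>X t - X (t + 1)\<close>. Pairing the equation with the conjugate
  of \<open>x\<close> and exchanging the order of summation moves the Mittag-Leffler kernel onto \<open>x\<close>; one
  summation by parts then turns the fractional term into \<open>\<Sum> p \<bar>y\<bar>\<^sup>2\<close> plus boundary terms
  \<open>p y (cnj X)\<close>, which are real because the boundary conditions make \<open>X\<close> and \<open>y\<close> linearly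
  dependent over the reals. Hence \<open>\<Lambda> (\<Sum> r \<bar>x\<bar>\<^sup>2)\<close> is real, the sum running over \<open>a + 1, \<dots>, b - 1\<close>.
  That sum does not vanish: if \<open>x\<close> were concentrated at \<open>a\<close>, the equation at \<open>a + 1\<close> would give
  \<open>p(a) x(a) = 0\<close>, since the kernel equals \<open>1 - \<alpha> \<noteq> 0\<close> at 1.\<close>

text \<open>Moves every sum from the real grid to natural indices. For \<open>m < i\<close> both
  sides are empty, which covers the integral operator evaluated one step past
  \<open>b - 1\<close>.\<close>

lemma dint_eq_image: "dint (a + real i) (a + real m) = (\<lambda>j. a + real j) ` {i..m}"
proof (intro equalityI subsetI)
  fix u assume "u \<in> dint (a + real i) (a + real m)"
  then obtain k where "u = a + real i + real k" "a + real i + real k \<le> a + real m"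
    by (auto simp: dint_def)
  then show "u \<in> (\<lambda>j. a + real j) ` {i..m}"
    by (intro image_eqI[where x = "i + k"]) auto
next
  fix u assume "u \<in> (\<lambda>j. a + real j) ` {i..m}"
  then obtain j where "i \<le> j" "j \<le> m" "u = a + real j" by auto
  then show "u \<in> dint (a + real i) (a + real m)"
    by (auto simp: dint_def intro!: exI[where x = "j - i"])
qed

lemma sum_dint: "sum f (dint (a + real i) (a + real m)) = (\<Sum>j=i..m. f (a + real j))"
  unfolding dint_eq_image by (subst sum.reindex) (auto simp: inj_on_def)

text \<open>At 1 the rising function is \<open>Gamma (1 + k * \<alpha>)\<close>, which cancels the
  denominator and leaves a geometric series.\<close>

lemma nabla_ML_1:
  assumes "0 \<le> \<alpha>" and "\<bar>\<mu>\<bar> < 1"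
  shows "nabla_ML \<alpha> \<mu> 1 = 1 / (1 - \<mu>)"
proof -
  have "Gamma (1 + real k * \<alpha>) > 0" for k
    using assms(1) by (intro Gamma_real_pos add_pos_nonneg) auto
  then have "rising 1 (real k * \<alpha>) / Gamma (\<alpha> * real k + 1) = 1" for k
    by (simp add: rising_def add.commute mult.commute less_imp_neq[symmetric])
  then have "nabla_ML \<alpha> \<mu> 1 = (\<Sum>k. \<mu> ^ k)"
    by (simp only: nabla_ML_def mult_1_right)
  with assms show ?thesis
    by (simp add: suminf_geometric)
qed

lemma sum_triangle_swap:
  fixes h :: "nat \<Rightarrow> nat \<Rightarrow> 'a::comm_monoid_add"
  shows "(\<Sum>t=1..m. \<Sum>s=1..t. h s t) = (\<Sum>s=1..m. \<Sum>t=s..m. h s t)"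
proof (induction m)
  case (Suc m)
  have "(\<Sum>s=1..m. \<Sum>t=s..Suc m. h s t) = (\<Sum>s=1..m. (\<Sum>t=s..m. h s t) + h s (Suc m))"
    by (intro sum.cong) auto
  with Suc show ?case
    by (simp add: sum.distrib add.assoc)
qed simp

text \<open>The remainder is kept in the form \<open>z s - z (Suc s)\<close> because the ABR
  difference is a multiple of exactly such a difference of \<open>X\<close>.\<close>

lemma sum_by_parts:
  fixes g z :: "nat \<Rightarrow> 'a::comm_ring_1"
  shows "(\<Sum>s=1..m. (g s - g (s - 1)) * z s)
    = g m * z m - g 0 * z 0 + (\<Sum>s<m. g s * (z s - z (Suc s)))"
  by (induction m) (simp_all add: algebra_simps)

text \<open>If \<open>d = 0\<close> then \<open>c \<noteq> 0\<close> forces \<open>u = 0\<close>;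
  otherwise \<open>v\<close> is a real multiple of \<open>u\<close>, and \<open>u * cnj u\<close> is
  real.\<close>

lemma mult_cnj_real_if_dependent:
  fixes c d :: real and u v :: complex
  assumes "of_real c * u + of_real d * v = 0" and "c\<^sup>2 + d\<^sup>2 \<noteq> 0"
  shows "v * cnj u \<in> \<real>"
proof (cases "d = 0")
  case True
  with assms show ?thesis by simp
next
  case False
  with assms(1) have "v = of_real (- c / d) * u"
    by (simp add: field_simps eq_neg_iff_add_eq_0 add.commute)
  then have "v * cnj u = of_real (- c / d) * (u * cnj u)" by (simp only: mult.assoc)
  then show ?thesis
    by (metis Reals_mult Reals_of_real complex_mult_cnj)
qed

text \<open>The left sum and \<open>X\<close> share one real kernel \<open>e\<close>, so they are
  adjoint to each other.\<close>

lemma weighted_pairing_real: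
  fixes x X y :: "nat \<Rightarrow> complex" and e p :: "nat \<Rightarrow> real" and \<kappa> :: real
  assumes X: "\<And>j. X j = (\<Sum>s=j..m. of_real (e (s - j)) * x s)"
    and y: "\<And>j. y j = of_real \<kappa> * (X j - X (Suc j))"
    and "y 0 * cnj (X 0) \<in> \<real>" and "y m * cnj (X m) \<in> \<real>"
  shows "(\<Sum>t=1..m. cnj (x t) * (of_real \<kappa> *
      (\<Sum>s=1..t. (of_real (p s) * y s - of_real (p (s - 1)) * y (s - 1)) * of_real (e (t - s))))) \<in> \<real>"
    (is "?S \<in> \<real>")
proof -
  let ?g = "\<lambda>s. of_real (p s) * y s"
  have "?S = of_real \<kappa> * (\<Sum>t=1..m. \<Sum>s=1..t. (?g s - ?g (s - 1)) * (of_real (e (t - s)) * cnj (x t)))"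
    by (simp add: sum_distrib_left mult_ac)
  \<comment> \<open>For fixed \<open>s\<close> the sum over \<open>t\<close> is
    \<open>cnj (X s)\<close>, because \<open>e\<close> is real.\<close>
  also have "\<dots> = of_real \<kappa> * (\<Sum>s=1..m. (?g s - ?g (s - 1)) * cnj (X s))"
    by (simp only: sum_triangle_swap) (simp add: X sum_distrib_left)
  also have "\<dots> = of_real \<kappa> * (?g m * cnj (X m) - ?g 0 * cnj (X 0))
      + (\<Sum>s<m. ?g s * (of_real \<kappa> * (cnj (X s) - cnj (X (Suc s)))))"
    by (subst sum_by_parts) (simp add: distrib_left sum_distrib_left mult_ac)
  \<comment> \<open>In the remainder the factor \<open>\<kappa>\<close> is absorbed to form
    \<open>cnj (y s)\<close>; it stays visible only at the boundary.\<close>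
  also have "\<dots> = of_real \<kappa> * (of_real (p m) * (y m * cnj (X m)) - of_real (p 0) * (y 0 * cnj (X 0)))
      + (\<Sum>s<m. of_real (p s) * (y s * cnj (y s)))"
    by (simp add: y mult_ac)
  also have "\<dots> \<in> \<real>"
  proof (intro Reals_add Reals_mult[of "of_real _"] Reals_diff sum_in_Reals Reals_of_real)
    show "y s * cnj (y s) \<in> \<real>" for s
      by (metis Reals_of_real complex_mult_cnj)
  qed (use assms(3,4) in simp_all)
  finally show ?thesis .
qed

lemma right_gen_int_shift:
  assumes "b - 1 = a + real m"
  shows "right_gen_int \<alpha> \<omega> b f (a + real i) =
    (\<Sum>s=i..m. of_real (nabla_ML \<alpha> \<omega> (real (s - i) + 1)) * f (a + real s))"
  unfolding right_gen_int_def assms sum_dint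
  by (intro sum.cong) (auto simp: \<rho>_def of_nat_diff algebra_simps)

lemma right_ABR_eq_right_gen_int:
  "right_ABR B \<alpha> b f t = of_real (B \<alpha> / (1 - \<alpha>)) *
    (right_gen_int \<alpha> (- \<alpha> / (1 - \<alpha>)) b f t - right_gen_int \<alpha> (- \<alpha> / (1 - \<alpha>)) b f (t + 1))"
proof -
  have "right_ABR B \<alpha> b f t = - of_real (B \<alpha> / (1 - \<alpha>)) *
      (right_gen_int \<alpha> (- \<alpha> / (1 - \<alpha>)) b f (t + 1) - right_gen_int \<alpha> (- \<alpha> / (1 - \<alpha>)) b f t)"
    unfolding right_ABR_def fdiff_def right_gen_int_def by (simp only: mult.commute[of "f _"])
  then show ?thesis by (simp only: mult_minus_left mult_minus_right[symmetric] minus_diff_eq)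
qed

text \<open>Truncated subtraction is harmless: \<open>1 \<le> s \<le> t\<close>, and at
  \<open>s = 1\<close> the difference reaches back to the value at \<open>a\<close>.\<close>

lemma left_ABC_shift:
  "left_ABC B \<alpha> a f (a + real t) = of_real (B \<alpha> / (1 - \<alpha>)) *
    (\<Sum>s=1..t. (f (a + real s) - f (a + real (s - 1))) *
      of_real (nabla_ML \<alpha> (- \<alpha> / (1 - \<alpha>)) (real (t - s) + 1)))"
proof -
  have "left_ABC B \<alpha> a f (a + real t) = of_real (B \<alpha> / (1 - \<alpha>)) *
      (\<Sum>s=1..t. nabla f (a + real s) *
        of_real (nabla_ML \<alpha> (- \<alpha> / (1 - \<alpha>)) (a + real t - \<rho> (a + real s))))"
    unfolding left_ABC_def by (simp only: sum_dint[of _ a 1 t, unfolded of_nat_1])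
  then show ?thesis
    by (simp only:) (intro arg_cong2[where f = "(*)"] refl sum.cong,
      auto simp: nabla_def \<rho>_def of_nat_diff algebra_simps)
qed

theorem theorem13:
  fixes a b \<alpha> c1 c2 d1 d2 :: real
    and B p q r :: "real \<Rightarrow> real"
    and n :: nat
  assumes "b - a = real n" and "n > 0"
    and nonempty: "dint (a + 1) (b - 1) \<noteq> {}"
    and "0 < \<alpha>" and "\<alpha> < 1 / 2"
    and "normalization_fun B"
    and "\<And>t. t \<in> dint a (b - 1) \<Longrightarrow> p t \<noteq> 0"
    and "\<And>t. t \<in> dint a (b - 1) \<Longrightarrow> r t > 0"
    and "c1\<^sup>2 + c2\<^sup>2 \<noteq> 0" and "d1\<^sup>2 + d2\<^sup>2 \<noteq> 0"
  shows "\<forall>\<Lambda>. SL_eigenvalue B \<alpha> a b p q r c1 c2 d1 d2 \<Lambda> \<longrightarrow> \<Lambda> \<in> \<real>"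
proof (intro allI impI)
  fix \<Lambda> assume "SL_eigenvalue B \<alpha> a b p q r c1 c2 d1 d2 \<Lambda>"
  then obtain x where x: "SL_eigenfunction B \<alpha> a b p q r c1 c2 d1 d2 \<Lambda> x"
    by (auto simp: SL_eigenvalue_def)
  define m where "m = n - 1"
  have b: "b - 1 = a + real m"
    using assms(1,2) by (simp add: m_def of_nat_diff)
  have dint_a: "dint a (b - 1) = (\<lambda>j. a + real j) ` {0..m}"
    using dint_eq_image[of a 0 m] b by simp
  have dint_a1: "dint (a + 1) (b - 1) = (\<lambda>j. a + real j) ` {1..m}"
    using dint_eq_image[of a 1 m] b by simp
  \<comment> \<open>Guarantees an equation at \<open>a + 1\<close>, without which an eigenfunction
    supported at \<open>a\<close> alone could not be excluded.\<close>
  have "1 \<le> m" using nonempty dint_a1 by auto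

  define \<mu> where "\<mu> = - \<alpha> / (1 - \<alpha>)"
  define \<kappa> where "\<kappa> = B \<alpha> / (1 - \<alpha>)"
  define e where "e j = nabla_ML \<alpha> \<mu> (real j + 1)" for j
  define X where "X j = right_gen_int \<alpha> \<mu> b x (a + real j)" for j
  define y where "y j = right_ABR B \<alpha> b x (a + real j)" for j
  define P where "P j = p (a + real j)" for j
  define R where "R j = r (a + real j)" for j
  define \<xi> where "\<xi> j = x (a + real j)" for j
  define L where "L t = of_real \<kappa> * (\<Sum>s=1..t. (of_real (P s) * y s - of_real (P (s - 1)) * y (s - 1))
      * of_real (e (t - s)))" for t

  have "\<kappa> > 0"
    using assms(4-6) by (auto simp: \<kappa>_def normalization_fun_def)
  \<comment> \<open>The bound \<open>\<alpha> < 1 / 2\<close> enters here, giving convergence of the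
    geometric series for \<open>e 0\<close>.\<close>
  have "\<bar>\<mu>\<bar> < 1"
    using assms(4,5) by (simp add: \<mu>_def field_simps)
  moreover have "\<mu> < 0"
    using assms(4,5) by (simp add: \<mu>_def field_simps)
  ultimately have "e 0 \<noteq> 0"
    using assms(4) nabla_ML_1[of \<alpha> \<mu>] by (simp add: e_def)
  \<comment> \<open>At \<open>j = Suc m\<close> the sum is empty, so \<open>y m\<close> is just
    \<open>\<kappa>\<close> times \<open>X m\<close>.\<close>
  have X: "X j = (\<Sum>s=j..m. of_real (e (s - j)) * \<xi> s)" for j
    by (simp add: X_def e_def \<xi>_def right_gen_int_shift[OF b])
  have y: "y j = of_real \<kappa> * (X j - X (Suc j))" for j
    unfolding y_def right_ABR_eq_right_gen_int X_def \<mu>_def \<kappa>_def by (simp add: add_ac)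
  have eq: "L t + of_real (q (a + real t)) * \<xi> t = \<Lambda> * of_real (R t) * \<xi> t" if "t \<in> {1..m}" for t
    using x that unfolding SL_eigenfunction_def dint_a1 ball_simps left_ABC_shift
    by (auto simp: L_def \<kappa>_def e_def \<mu>_def P_def y_def \<xi>_def R_def)
  have "of_real c1 * X 0 + of_real c2 * y 0 = 0" "of_real d1 * X m + of_real d2 * y m = 0"
    using x by (simp_all add: SL_eigenfunction_def X_def y_def \<mu>_def b)
  with assms(9,10) have bdry: "y 0 * cnj (X 0) \<in> \<real>" "y m * cnj (X m) \<in> \<real>"
    using mult_cnj_real_if_dependent by blast+
  have R_pos: "R t > 0" if "t \<in> {0..m}" for t
    using assms(8) that by (auto simp: R_def dint_a)

  have nontrivial: "\<exists>t\<in>{1..m}. \<xi> t \<noteq> 0"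
  proof (rule ccontr)
    assume "\<not> ?thesis"
    then have zero: "\<xi> t = 0" if "t \<in> {1..m}" for t using that by blast
    have "X j = 0" if "j \<ge> 1" for j
      using that by (auto simp: X zero intro!: sum.neutral)
    moreover have "X 0 = of_real (e 0) * \<xi> 0"
      by (simp add: X sum.atLeast_Suc_atMost zero)
    \<comment> \<open>Here \<open>y 1 = 0\<close>, so only the term with \<open>y 0\<close>
      survives; one pair of factors \<open>\<kappa>\<close> and \<open>e 0\<close> comes from
      \<open>L\<close>, the other from \<open>y 0\<close>.\<close>
    ultimately have "L 1 = - (of_real \<kappa> * of_real (P 0) * of_real \<kappa> * of_real (e 0) * of_real (e 0) * \<xi> 0)"
      by (simp add: L_def y)
    moreover have "L 1 = 0"
      using eq[of 1] zero[of 1] \<open>1 \<le> m\<close> by simp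
    moreover have "P 0 \<noteq> 0"
      using assms(7)[of "a + real 0"] by (auto simp: P_def dint_a)
    ultimately have "\<xi> 0 = 0"
      using \<open>\<kappa> > 0\<close> \<open>e 0 \<noteq> 0\<close> by simp
    moreover obtain t where "t \<in> {0..m}" "\<xi> t \<noteq> 0"
      using x by (auto simp: SL_eigenfunction_def dint_a \<xi>_def)
    ultimately show False
      using zero[of t] by (cases t) auto
  qed

  let ?N = "\<Sum>t=1..m. R t * (cmod (\<xi> t))\<^sup>2"
  have "\<Lambda> * of_real ?N = (\<Sum>t=1..m. cnj (\<xi> t) * (\<Lambda> * of_real (R t) * \<xi> t))"
    by (simp add: sum_distrib_left complex_norm_square mult_ac del: of_real_power)
  also have "\<dots> = (\<Sum>t=1..m. cnj (\<xi> t) * L t + of_real (q (a + real t) * (cmod (\<xi> t))\<^sup>2))"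
    by (intro sum.cong refl, subst eq[symmetric])
       (simp_all add: complex_norm_square algebra_simps del: of_real_power)
  also have "\<dots> = (\<Sum>t=1..m. cnj (\<xi> t) * L t) + of_real (\<Sum>t=1..m. q (a + real t) * (cmod (\<xi> t))\<^sup>2)"
    by (simp add: sum.distrib)
  also have "\<dots> \<in> \<real>"
    unfolding L_def by (intro Reals_add Reals_of_real weighted_pairing_real[OF X y] bdry)
  finally have "\<Lambda> * of_real ?N \<in> \<real>" .
  moreover have "?N > 0"
  proof -
    obtain t where t: "t \<in> {1..m}" "\<xi> t \<noteq> 0" using nontrivial by blast
    show ?thesis
      by (rule sum_pos2[OF _ t(1)]) (use t R_pos in \<open>auto intro!: mult_nonneg_nonneg intro: less_imp_le\<close>)
  qed
  ultimately have "\<Lambda> * of_real ?N / of_real ?N \<in> \<real>" "of_real ?N \<noteq> (0::complex)"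
    by (blast intro: Reals_divide Reals_of_real, simp only: of_real_eq_0_iff)
  then show "\<Lambda> \<in> \<real>" by simp
qed

end
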